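(* Let $n\ge 1$ be an integer and let $B_n$ be the $n$-barbell graph. Then $$\mathcal{L}(B_n)=2\,(n-1)!\,n!\,C_n,$$ where $C_n=\frac{1}{n+1}\binom{2n}{n}$ is the $n$th Catalan number.
   Context: Let $H$ be a finite, connected, undirected graph with vertex set $V$. A random walk labeling of $H$ is a labeling of $V$ obtainable by the following process: (1) set $i=1$, choose any $v\in V$ and label $v$ with $i$; (2) as long as there are unlabeled vertices, choose a vertex $w$ adjacent to the current vertex $v$ and replace $v$ by $w$; if this new $v$ is not labeled, increase $i$ by $1$ and label $v$ with $i$. The number of different random walk labelings of $H$ is denoted by $\mathcal{L}(H)$. The $n$-barbell graph $B_n$ is obtained from two disjoint copies of the complete graph $K_n$ by adding a single edge (a bridge) between a vertex of the first copy and a vertex of the second copy. *)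

theory Defs
  imports Complex_Main "Graph_Theory.Graph_Theory"
begin

text \<open>
  Undirected simple graphs are the finite symmetric loop-free digraphs of the library: an edge
  between \<open>u\<close> and \<open>v\<close> is the pair of arcs \<open>(u,v)\<close>, \<open>(v,u)\<close>.

  A state \<open>v i l\<close> of the process consists of the current vertex \<open>v\<close>, the last label \<open>i\<close> that was
  used, and the partial labeling \<open>l\<close> built so far (\<open>l w = None\<close> iff \<open>w\<close> is still unlabeled).
\<close>

inductive rw_state :: "('a, 'b) pre_digraph \<Rightarrow> 'a \<Rightarrow> nat \<Rightarrow> ('a \<rightharpoonup> nat) \<Rightarrow> bool"
  for H :: "('a, 'b) pre_digraph" where
  start: "v \<in> verts H \<Longrightarrow> rw_state H v 1 [v \<mapsto> 1]"
| move: "rw_state H v i l \<Longrightarrow> dom l \<noteq> verts H \<Longrightarrow> v \<rightarrow>\<^bsub>H\<^esub> w \<Longrightarrow> w \<in> dom l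
    \<Longrightarrow> rw_state H w i l"
| move_label: "rw_state H v i l \<Longrightarrow> dom l \<noteq> verts H \<Longrightarrow> v \<rightarrow>\<^bsub>H\<^esub> w \<Longrightarrow> w \<notin> dom l
    \<Longrightarrow> rw_state H w (i + 1) (l(w \<mapsto> i + 1))"

definition random_walk_labeling :: "('a, 'b) pre_digraph \<Rightarrow> ('a \<rightharpoonup> nat) \<Rightarrow> bool" where
  "random_walk_labeling H l \<longleftrightarrow> dom l = verts H \<and> (\<exists>v i. rw_state H v i l)"

definition num_random_walk_labelings :: "('a, 'b) pre_digraph \<Rightarrow> nat" where
  "num_random_walk_labelings H = card {l. random_walk_labeling H l}"

definition barbell_graph :: "nat \<Rightarrow> 'a pair_pre_digraph \<Rightarrow> bool" where
  "barbell_graph n B \<longleftrightarrow> (\<exists>(K1 :: 'a pair_pre_digraph) (K2 :: 'a pair_pre_digraph) u v.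
     complete_digraph n (with_proj K1) \<and> complete_digraph n (with_proj K2) \<and>
     pverts K1 \<inter> pverts K2 = {} \<and> u \<in> pverts K1 \<and> v \<in> pverts K2 \<and>
     B = \<lparr> pverts = pverts K1 \<union> pverts K2, parcs = parcs K1 \<union> parcs K2 \<union> {(u, v), (v, u)} \<rparr>)"

definition catalan :: "nat \<Rightarrow> real" where
  "catalan n = 1 / (real n + 1) * real ((2 * n) choose n)"

lemma barbell_graph_pair_graph:
  assumes "barbell_graph n B"
  shows "pair_graph B"
proof -
  obtain K1 K2 :: "'a pair_pre_digraph" and u v where K:
    "complete_digraph n (with_proj K1)" "complete_digraph n (with_proj K2)"
    "pverts K1 \<inter> pverts K2 = {}" "u \<in> pverts K1" "v \<in> pverts K2"
    and B: "B = \<lparr> pverts = pverts K1 \<union> pverts K2,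
      parcs = parcs K1 \<union> parcs K2 \<union> {(u, v), (v, u)} \<rparr>"
    using assms unfolding barbell_graph_def by blast
  have fin: "finite (pverts B)" and sub: "parcs B \<subseteq> pverts B \<times> pverts B"
    using K unfolding complete_digraph_pair_def B by auto
  have "finite (parcs B)"
    using finite_subset[OF sub] fin by blast
  moreover have "sym (parcs B)"
    using K unfolding complete_digraph_pair_def B by (auto simp: sym_def)
  moreover have "fst e \<noteq> snd e" if "e \<in> parcs B" for e
    using K that unfolding complete_digraph_pair_def B by auto
  ultimately show ?thesis
    using fin sub by unfold_locales (auto simp: symmetric_def)
qed

lemma barbell_graph_connected:
  assumes "barbell_graph n B"
  shows "connected (with_proj B)"
proof -
  obtain K1 K2 :: "'a pair_pre_digraph" and u v where K:
    "complete_digraph n (with_proj K1)" "complete_digraph n (with_proj K2)"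
    "pverts K1 \<inter> pverts K2 = {}" "u \<in> pverts K1" "v \<in> pverts K2"
    and B: "B = \<lparr> pverts = pverts K1 \<union> pverts K2,
      parcs = parcs K1 \<union> parcs K2 \<union> {(u, v), (v, u)} \<rparr>"
    using assms unfolding barbell_graph_def by blast
  interpret pair_graph B using assms by (rule barbell_graph_pair_graph)
  have arc: "(x, y) \<in> parcs B \<Longrightarrow> x \<rightarrow>\<^sup>*\<^bsub>B\<^esub> y" for x y
    by (rule reachable_adjI) simp
  have K1: "x \<rightarrow>\<^sup>*\<^bsub>B\<^esub> y" if "x \<in> pverts K1" "y \<in> pverts K1" for x y
  proof (cases "x = y")
    case True
    moreover from that have "y \<in> pverts B" by (simp add: B)
    ultimately show ?thesis using reachable_refl by simp
  next
    case False
    with that K(1) have "(x, y) \<in> parcs B" by (simp add: complete_digraph_pair_def B)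
    then show ?thesis by (rule arc)
  qed
  have K2: "x \<rightarrow>\<^sup>*\<^bsub>B\<^esub> y" if "x \<in> pverts K2" "y \<in> pverts K2" for x y
  proof (cases "x = y")
    case True
    moreover from that have "y \<in> pverts B" by (simp add: B)
    ultimately show ?thesis using reachable_refl by simp
  next
    case False
    with that K(2) have "(x, y) \<in> parcs B" by (simp add: complete_digraph_pair_def B)
    then show ?thesis by (rule arc)
  qed
  have uv: "u \<rightarrow>\<^sup>*\<^bsub>B\<^esub> v" "v \<rightarrow>\<^sup>*\<^bsub>B\<^esub> u"
    by (rule arc, simp add: B)+
  have via_u: "x \<rightarrow>\<^sup>*\<^bsub>B\<^esub> u" "u \<rightarrow>\<^sup>*\<^bsub>B\<^esub> x" if "x \<in> pverts B" for x
  proof -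
    from that consider "x \<in> pverts K1" | "x \<in> pverts K2" by (auto simp: B)
    then have "x \<rightarrow>\<^sup>*\<^bsub>B\<^esub> u \<and> u \<rightarrow>\<^sup>*\<^bsub>B\<^esub> x"
    proof cases
      case 1
      then show ?thesis using K1 K(4) by blast
    next
      case 2
      then show ?thesis
        using reachable_trans[OF K2[OF 2 K(5)] uv(2)] reachable_trans[OF uv(1) K2[OF K(5) 2]] by blast
    qed
    then show "x \<rightarrow>\<^sup>*\<^bsub>B\<^esub> u" "u \<rightarrow>\<^sup>*\<^bsub>B\<^esub> x" by blast+
  qed
  have "strongly_connected (with_proj B)"
  proof (rule strongly_connectedI)
    show "verts (with_proj B) \<noteq> {}" using K by (auto simp: B)
    fix x y assume "x \<in> verts (with_proj B)" "y \<in> verts (with_proj B)"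
    then show "x \<rightarrow>\<^sup>*\<^bsub>B\<^esub> y"
      using reachable_trans[OF via_u(1) via_u(2)] by simp
  qed
  then show ?thesis
    using reachable_mk_symmetricI
    unfolding connected_def strongly_connected_def by auto
qed

lemma barbell_graph_exists:
  assumes "n \<ge> 1"
  shows "\<exists>B :: nat pair_pre_digraph. barbell_graph n B"
proof -
  define K where "K A = \<lparr> pverts = A, parcs = {(x, y). (x, y) \<in> A \<times> A \<and> x \<noteq> y} \<rparr>" for A :: "nat set"
  have "complete_digraph n (with_proj (K {..<n}))" "complete_digraph n (with_proj (K {n..<2 * n}))"
    by (auto simp: complete_digraph_pair_def K_def)
  moreover have "pverts (K {..<n}) \<inter> pverts (K {n..<2 * n}) = {}"
    "0 \<in> pverts (K {..<n})" "n \<in> pverts (K {n..<2 * n})"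
    using assms by (auto simp: K_def)
  ultimately show ?thesis unfolding barbell_graph_def by blast
qed

end

theory Submission
  imports Defs "HOL-Library.FuncSet" "HOL-Combinatorics.Transposition"
begin

text \<open>
  In a symmetric graph the walker can reach every labeled vertex without leaving the labeled set,
  so the random walk labelings are exactly the bijections \<open>f\<close> from the vertices to \<open>{1..N}\<close> such
  that every vertex with label different from \<open>1\<close> has a neighbour with a smaller label. For the
  barbell graph with bridge \<open>uv\<close>, \<open>u \<in> K1\<close>, \<open>v \<in> K2\<close>, and a walk starting in \<open>K1\<close>, this says that \<open>u\<close>
  and \<open>v\<close> receive, in this order, the two smallest labels in the set \<open>{u} \<union> K2\<close> of size \<open>n + 1\<close>. By
  symmetry this holds for \<open>(2n)! / ((n + 1) n)\<close> of all \<open>(2n)!\<close> bijections, and the other starting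
  side contributes the same number.
\<close>

text \<open>For finite \<open>V\<close>, an injection into \<open>{1..card V}\<close> is a
  bijection. Extensionality makes a labeling determined by its values on \<open>V\<close>, so that
  labelings can be counted.\<close>

definition bijective_labelings :: "'a set \<Rightarrow> ('a \<Rightarrow> nat) set" where
  "bijective_labelings V = {f \<in> V \<rightarrow>\<^sub>E {1..card V}. inj_on f V}"

definition two_least :: "('a \<Rightarrow> nat) \<Rightarrow> 'a set \<Rightarrow> 'a \<Rightarrow> 'a \<Rightarrow> bool" where
  "two_least f S a b \<longleftrightarrow> f a < f b \<and> (\<forall>w\<in>S - {a, b}. f b < f w)"

text \<open>For a bijective labeling of a finite symmetric graph this is the local form of a
  connectedness condition: for each i \<ge> 1 the vertices with labels at most i induce a connected
  subgraph.\<close>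

definition connected_labeling :: "('a, 'b) pre_digraph \<Rightarrow> ('a \<Rightarrow> nat) \<Rightarrow> bool" where
  "connected_labeling H f \<longleftrightarrow>
     (\<forall>w\<in>verts H. f w \<noteq> 1 \<longrightarrow> (\<exists>x\<in>verts H. x \<rightarrow>\<^bsub>H\<^esub> w \<and> f x < f w))"

section \<open>Labelings with prescribed least elements\<close>

lemma finite_bijective_labelings: "finite V \<Longrightarrow> finite (bijective_labelings V)"
  unfolding bijective_labelings_def by (simp add: finite_PiE)

lemma card_bijective_labelings:
  assumes "finite V"
  shows "card (bijective_labelings V) = fact (card V)"
  using card_inj_on_subset_funcset[OF assms, of "{1..card V}" V]
  by (simp add: bijective_labelings_def fact_prod_rev)

lemma bijective_labelings_image:
  assumes "finite V" "f \<in> bijective_labelings V"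
  shows "f ` V = {1..card V}"
  using assms by (intro card_subset_eq) (auto simp: bijective_labelings_def card_image)

lemma bijective_labelings_comp:
  assumes "f \<in> bijective_labelings V" "bij_betw p V V" "\<And>x. x \<notin> V \<Longrightarrow> p x = x"
  shows "f \<circ> p \<in> bijective_labelings V"
proof -
  have "p ` V = V" "inj_on p V" using assms(2) by (auto simp: bij_betw_def)
  moreover from this have "inj_on (f \<circ> p) V"
    using assms(1) by (intro comp_inj_on) (auto simp: bijective_labelings_def)
  ultimately show ?thesis
    using assms(1,3) by (force simp: bijective_labelings_def PiE_iff extensional_def)
qed

text \<open>Precomposition with a permutation that preserves \<open>S\<close> and sends
  \<open>c\<close> to \<open>a\<close> and \<open>d\<close> to \<open>b\<close> maps the first set
  injectively into the second. Exchanging the two pairs then gives equality.\<close>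

lemma card_two_least_le:
  assumes "finite V" "S \<subseteq> V" "a \<in> S" "b \<in> S" "a \<noteq> b" "c \<in> S" "d \<in> S" "c \<noteq> d"
  shows "card {f \<in> bijective_labelings V. two_least f S a b}
       \<le> card {f \<in> bijective_labelings V. two_least f S c d}"
proof -
  \<comment> \<open>\<open>transpose c a\<close> sends \<open>c\<close> to \<open>a\<close> and
    moves \<open>d\<close> to \<open>e\<close>; \<open>transpose e b\<close> then sends
    \<open>e\<close> to \<open>b\<close> and fixes \<open>a\<close>, which differs from both
    \<open>e\<close> and \<open>b\<close>.\<close>
  define e where "e = transpose c a d"
  define p where "p = transpose e b \<circ> transpose c a"
  have e: "e \<in> S" "e \<noteq> a"
    using assms unfolding e_def by (auto simp: transpose_def)
  have p: "p c = a" "p d = b"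
    using e assms unfolding p_def e_def by (simp_all add: transpose_def)
  have pS: "p x \<in> S" if "x \<in> S" for x
    using that assms e unfolding p_def by (auto simp: transpose_def)
  have fixed: "p x = x" if "x \<notin> S" for x
    using that assms e unfolding p_def by (auto simp: transpose_def)
  have bij: "bij p" unfolding p_def by (intro bij_comp) auto
  have "p ` V \<subseteq> V" using pS fixed assms(2) by (metis image_subsetI subsetD)
  moreover have "inj_on p V"
    using bij_is_inj[OF bij] by (rule inj_on_subset) simp
  ultimately have pV: "bij_betw p V V"
    using assms(1) endo_inj_surj[of V p] by (simp add: bij_betw_def)
  show ?thesis
  proof (rule card_inj_on_le)
    show "inj_on (\<lambda>f. f \<circ> p) {f \<in> bijective_labelings V. two_least f S a b}"
      using bij by (intro inj_onI ext) (metis bij_pointE comp_apply)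
    show "(\<lambda>f. f \<circ> p) ` {f \<in> bijective_labelings V. two_least f S a b}
        \<subseteq> {f \<in> bijective_labelings V. two_least f S c d}"
    proof clarify
      fix f assume f: "f \<in> bijective_labelings V" "two_least f S a b"
      have "p w \<in> S - {a, b}" if "w \<in> S - {c, d}" for w
        using that pS p bij by (metis Diff_iff bij_def injD insertE insertI1 insert_commute singletonD)
      then have "two_least (f \<circ> p) S c d" using f(2) p by (simp add: two_least_def)
      moreover have "f \<circ> p \<in> bijective_labelings V"
        using bijective_labelings_comp[OF f(1) pV] fixed assms(2) by blast
      ultimately show "f \<circ> p \<in> bijective_labelings V \<and> two_least (f \<circ> p) S c d" by blast
    qed
    show "finite {f \<in> bijective_labelings V. two_least f S c d}"
      using finite_bijective_labelings[OF assms(1)] by simp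
  qed
qed

text \<open>Each labeling has exactly one ordered pair of distinct elements of \<open>S\<close> as
  its least and second least. The ordered pairs thus split all labelings into
  \<open>card S * (card S - 1)\<close> classes, which have equal size.\<close>

lemma card_two_least:
  assumes "finite V" "S \<subseteq> V" "a \<in> S" "b \<in> S" "a \<noteq> b"
  shows "card S * (card S - 1) * card {f \<in> bijective_labelings V. two_least f S a b} = fact (card V)"
proof -
  let ?A = "\<lambda>(c, d). {f \<in> bijective_labelings V. two_least f S c d}"
  let ?I = "SIGMA c:S. S - {c}"
  have finS: "finite S" using assms finite_subset by blast
  have eq: "card (?A i) = card (?A (a, b))" if "i \<in> ?I" for i
    using that assms card_two_least_le[OF assms(1,2)] by (force intro!: antisym)
  have disj: "?A i \<inter> ?A j = {}" if "i \<in> ?I" "j \<in> ?I" "i \<noteq> j" for i j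
    using that unfolding two_least_def by (auto; metis Diff_iff insertE less_asym less_trans singletonD)
  have cover: "bijective_labelings V = (\<Union>i\<in>?I. ?A i)"
  proof (intro equalityI subsetI)
    fix f assume f: "f \<in> bijective_labelings V"
    then have inj: "inj_on f S"
      using assms(2) inj_on_subset unfolding bijective_labelings_def by blast
    \<comment> \<open>The class of \<open>f\<close> is given by its minimiser on \<open>S\<close>
      and its minimiser on the rest; injectivity makes the inequalities strict.\<close>
    define c where "c = arg_min_on f S"
    define d where "d = arg_min_on f (S - {c})"
    have c: "c \<in> S" "f c \<le> f w" if "w \<in> S" for w
      using that assms finS arg_min_if_finite(1)[of S f] arg_min_least[of S w f]
      unfolding c_def by auto
    have ne: "S - {c} \<noteq> {}" using assms by auto
    have d: "d \<in> S - {c}" "w \<in> S - {c} \<Longrightarrow> f d \<le> f w" for w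
      using ne finS arg_min_if_finite(1)[of "S - {c}" f] arg_min_least[of "S - {c}" w f]
      unfolding d_def by auto
    have "two_least f S c d"
      unfolding two_least_def
      using c d inj assms(3) by (metis DiffD1 DiffD2 DiffI inj_on_eq_iff insert_iff le_neq_implies_less)
    then show "f \<in> (\<Union>i\<in>?I. ?A i)"
      using f c(1)[OF assms(3)] d(1) by blast
  qed auto
  have "fact (card V) = card (\<Union>i\<in>?I. ?A i)"
    using card_bijective_labelings[OF assms(1)] cover by simp
  also have "\<dots> = (\<Sum>i\<in>?I. card (?A i))"
    using finS disj finite_bijective_labelings[OF assms(1)]
    by (intro card_UN_disjoint) auto
  also have "\<dots> = (\<Sum>i\<in>?I. card (?A (a, b)))"
    using eq by (rule sum.cong[OF refl])
  also have "\<dots> = card ?I * card (?A (a, b))"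
    by simp
  also have "card ?I = card S * (card S - 1)"
    using finS by (simp add: card_Diff_singleton)
  finally show ?thesis by simp
qed

section \<open>Random walk labelings\<close>

text \<open>The last conjunct replaces the walk by a static condition: a newly labeled vertex is
  entered from one that already has a label. \<open>v \<in> dom l\<close> supplies that label, and
  \<open>ran l \<subseteq> {1..i}\<close> makes \<open>i + 1\<close> both new and larger.\<close>

lemma rw_state_invariant:
  assumes "rw_state H v i l" "finite (verts H)" "\<And>x y. x \<rightarrow>\<^bsub>H\<^esub> y \<Longrightarrow> x \<in> verts H \<and> y \<in> verts H"
  shows "v \<in> dom l \<and> dom l \<subseteq> verts H \<and> card (dom l) = i \<and> ran l \<subseteq> {1..i} \<and> inj_on l (dom l) \<and>
    (\<forall>w k. l w = Some k \<longrightarrow> k \<noteq> 1 \<longrightarrow> (\<exists>x j. l x = Some j \<and> x \<rightarrow>\<^bsub>H\<^esub> w \<and> j < k))"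
  using assms(1)
proof induction
  case (start v)
  have "dom [v \<mapsto> 1 :: nat] = {v}" "ran [v \<mapsto> 1 :: nat] = {1}" by auto
  moreover have "k = 1" if "[v \<mapsto> 1 :: nat] w = Some k" for w k
    using that by (simp split: if_splits)
  ultimately show ?case using start by (simp del: fun_upd_apply)
next
  case (move v i l w)
  then show ?case by auto
next
  case (move_label v i l w)
  have fin: "finite (dom l)"
    using move_label.IH assms(2) finite_subset by blast
  have ran: "j \<in> {1..i}" if "l x = Some j" for x j
    using move_label.IH ranI[of l x j] that by blast
  have 1: "w \<in> dom (l(w \<mapsto> i + 1)) \<and> dom (l(w \<mapsto> i + 1)) \<subseteq> verts H \<and> card (dom (l(w \<mapsto> i + 1))) = i + 1"
    using move_label assms(3) fin by auto
  have 2: "ran (l(w \<mapsto> i + 1)) \<subseteq> {1..i + 1}"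
  proof
    fix j assume "j \<in> ran (l(w \<mapsto> i + 1))"
    then consider "j = i + 1" | x where "l x = Some j"
      by (auto simp: ran_def split: if_splits)
    then show "j \<in> {1..i + 1}" using ran by cases force+
  qed
  have 3: "inj_on (l(w \<mapsto> i + 1)) (dom (l(w \<mapsto> i + 1)))"
  proof -
    have "l x \<noteq> Some (i + 1)" for x using ran[of x "i + 1"] by auto
    then have "Some (i + 1) \<notin> l ` dom l" by (metis imageE)
    moreover have "inj_on l (dom l)" using move_label.IH by blast
    ultimately show ?thesis using inj_on_fun_updI[of l "dom l" "Some (i + 1)" w] by auto
  qed
  obtain j where j: "l v = Some j" using move_label.IH by blast
  have 4: "\<exists>x j. (l(w \<mapsto> i + 1)) x = Some j \<and> x \<rightarrow>\<^bsub>H\<^esub> z \<and> j < k"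
    if z: "(l(w \<mapsto> i + 1)) z = Some k" "k \<noteq> 1" for z k
  proof (cases "z = w")
    case True
    have "v \<noteq> w" using j move_label.hyps by auto
    then show ?thesis using True z j ran[OF j] move_label.hyps by (intro exI[of _ v] exI[of _ j]) auto
  next
    case False
    then have "l z = Some k" using z by simp
    then obtain x j where x: "l x = Some j" "x \<rightarrow>\<^bsub>H\<^esub> z" "j < k"
      using z(2) move_label.IH by blast
    \<comment> \<open>\<open>x\<close> already has a label and \<open>w\<close> has none, so the
      update at \<open>w\<close> leaves the label of \<open>x\<close> unchanged.\<close>
    moreover have "x \<noteq> w" using x move_label.hyps by auto
    ultimately show ?thesis by (intro exI[of _ x] exI[of _ j]) auto
  qed
  show ?case using 1 2 3 4 by blast
qed

text \<open>The walk labels the vertices in the order of \<open>f\<close>. Between two new labels it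
  must travel to a neighbour of the next vertex: it descends through smaller neighbours to the
  vertex labeled 1, from which every labeled vertex can be reached.\<close>

lemma rw_state_complete:
  assumes f: "f \<in> bijective_labelings (verts H)" and con: "connected_labeling H f"
    and fin: "finite (verts H)" and sym: "\<And>x y. x \<rightarrow>\<^bsub>H\<^esub> y \<Longrightarrow> y \<rightarrow>\<^bsub>H\<^esub> x"
    and i: "1 \<le> i" "i \<le> card (verts H)"
  shows "\<exists>v. rw_state H v i (\<lambda>x. if x \<in> verts H \<and> f x \<le> i then Some (f x) else None)"
  using i
proof (induction i rule: nat_induct_at_least)
  case base
  obtain r where r: "r \<in> verts H" "f r = 1"
    using bijective_labelings_image[OF fin f] base by (metis atLeastAtMost_iff imageE order_refl)
  have "(\<lambda>x. if x \<in> verts H \<and> f x \<le> 1 then Some (f x) else None) = [r \<mapsto> 1]"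
  proof
    fix x
    have "x = r" if x: "x \<in> verts H" "f x \<le> 1"
    proof (rule inj_onD[of f "verts H"])
      have "1 \<le> f x" using f x(1) by (auto simp: bijective_labelings_def PiE_iff)
      then show "f x = f r" using x(2) r(2) by simp
    qed (use f x r in \<open>auto simp: bijective_labelings_def\<close>)
    then show "(if x \<in> verts H \<and> f x \<le> 1 then Some (f x) else None) = [r \<mapsto> 1] x"
      using r by (cases "x = r") (simp, fastforce)
  qed
  then show ?case using rw_state.start[OF r(1)] by (intro exI[of _ r]) simp
next
  case (Suc i)
  let ?l = "\<lambda>i x. if x \<in> verts H \<and> f x \<le> i then Some (f x) else None"
  define D where "D = {x \<in> verts H. f x \<le> i}"
  have dom: "dom (?l i) = D" by (auto simp: D_def split: if_splits)
  obtain w where w: "w \<in> verts H" "f w = Suc i"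
    using bijective_labelings_image[OF fin f] Suc.prems
    by (metis atLeastAtMost_iff imageE le_add1 plus_1_eq_Suc)
  have "w \<notin> D" using w(2) by (simp add: D_def)
  \<comment> \<open>Moves are allowed only while the labeling is incomplete, which the unlabeled
    \<open>w\<close> guarantees.\<close>
  then have nD: "dom (?l i) \<noteq> verts H" using w(1) unfolding dom by blast
  \<comment> \<open>The vertices at which the walker can stand once exactly the labels up to
    \<open>i\<close> are assigned.\<close>
  define R where "R = {x. rw_state H x i (?l i)}"
  have step: "y \<in> R" if "x \<in> R" "x \<rightarrow>\<^bsub>H\<^esub> y" "y \<in> D" for x y
    unfolding R_def mem_Collect_eq
    using that(1)[unfolded R_def mem_Collect_eq] nD that(2) that(3)[folded dom] by (rule rw_state.move)
  obtain v where v: "v \<in> R" using Suc unfolding R_def by auto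
  have "v \<in> D"
  proof -
    have "rw_state H x j l \<Longrightarrow> x \<in> dom l" for x j l
      by (induction rule: rw_state.induct) auto
    from this[OF v[unfolded R_def mem_Collect_eq]] show ?thesis unfolding dom .
  qed
  have down: "\<exists>x\<in>D. x \<rightarrow>\<^bsub>H\<^esub> y \<and> f x < f y" if "y \<in> D" "f y \<noteq> 1" for y
    using con that unfolding connected_labeling_def D_def by fastforce
  \<comment> \<open>The smaller neighbour is given by an arc into the current vertex; symmetry lets
    the walker follow it backwards.\<close>
  have root: "\<exists>r\<in>R \<inter> D. f r = 1"
    using v \<open>v \<in> D\<close>
  proof (induction "f v" arbitrary: v rule: less_induct)
    case less
    show ?case
    proof (cases "f v = 1")
      case False
      then obtain x where "x \<in> D" "x \<rightarrow>\<^bsub>H\<^esub> v" "f x < f v" using down less.prems by blast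
      then show ?thesis using less step sym by blast
    qed (use less.prems in blast)
  qed
  then obtain r where r: "r \<in> R" "r \<in> D" "f r = 1" by blast
  \<comment> \<open>Now the arcs are followed forwards: \<open>y\<close> is entered from a smaller
    neighbour, which is in \<open>R\<close> by induction, starting from \<open>r\<close>, the only
    vertex labeled 1.\<close>
  have all: "y \<in> R" if "y \<in> D" for y
    using that
  proof (induction "f y" arbitrary: y rule: less_induct)
    case (less y)
    show ?case
    proof (cases "f y = 1")
      case True
      then have "f y = f r" using r by simp
      moreover have "inj_on f (verts H)" using f by (simp add: bijective_labelings_def)
      ultimately have "y = r" using less.prems r(2) by (auto simp: D_def dest: inj_onD)
      then show ?thesis using r by simp
    next
      case False
      then show ?thesis using down[of y] less step[of _ y] by blast
    qed
  qed
  obtain x where x: "x \<in> verts H" "x \<rightarrow>\<^bsub>H\<^esub> w" "f x < f w"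
    using con w Suc.hyps unfolding connected_labeling_def by force
  then have xR: "rw_state H x i (?l i)" using w all unfolding D_def R_def by auto
  have "w \<notin> dom (?l i)" using \<open>w \<notin> D\<close> unfolding dom .
  with xR nD x(2) have "rw_state H w (i + 1) ((?l i)(w \<mapsto> i + 1))"
    by (rule rw_state.move_label)
  moreover have "(?l i)(w \<mapsto> i + 1) = ?l (Suc i)"
  proof
    fix z
    have "z = w" if "z \<in> verts H" "f z = Suc i"
      using inj_onD[of f "verts H" z w] that f w by (simp add: bijective_labelings_def)
    then show "((?l i)(w \<mapsto> i + 1)) z = ?l (Suc i) z"
      using w by (cases "z = w") (simp, fastforce simp: le_Suc_eq)
  qed
  ultimately show ?case by (intro exI[of _ w]) simp
qed

text \<open>One inclusion is the invariant of the walk, the other its completeness at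
  \<open>i = card (verts H)\<close>. Wrapping in \<open>Some\<close> only translates extensional
  functions into partial maps.\<close>

lemma random_walk_labelings_eq:
  assumes fin: "finite (verts H)" and sym: "\<And>x y. x \<rightarrow>\<^bsub>H\<^esub> y \<Longrightarrow> y \<rightarrow>\<^bsub>H\<^esub> x"
    and wf: "\<And>x y. x \<rightarrow>\<^bsub>H\<^esub> y \<Longrightarrow> x \<in> verts H \<and> y \<in> verts H" and ne: "verts H \<noteq> {}"
  shows "{l. random_walk_labeling H l} =
    (\<lambda>f x. if x \<in> verts H then Some (f x) else None) `
      {f \<in> bijective_labelings (verts H). connected_labeling H f}" (is "?L = ?g ` ?F")
proof (intro equalityI subsetI)
  fix l assume "l \<in> ?L"
  then obtain v i where dom: "dom l = verts H" and "rw_state H v i l"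
    unfolding random_walk_labeling_def by blast
  then have inv: "card (verts H) = i" "ran l \<subseteq> {1..i}" "inj_on l (verts H)"
    "\<And>w k. l w = Some k \<Longrightarrow> k \<noteq> 1 \<Longrightarrow> \<exists>x j. l x = Some j \<and> x \<rightarrow>\<^bsub>H\<^esub> w \<and> j < k"
    using rw_state_invariant[of H v i l] fin wf by auto
  define f where "f = restrict (the \<circ> l) (verts H)"
  have lf: "l x = Some (f x)" if "x \<in> verts H" for x
    using that dom unfolding f_def by force
  have "inj_on f (verts H)"
    using inv(3) lf by (simp add: inj_on_def)
  moreover have "f x \<in> {1..i}" if "x \<in> verts H" for x
    using inv(2) ranI[of l x "f x"] lf[OF that] by blast
  ultimately have "f \<in> bijective_labelings (verts H)"
    unfolding bijective_labelings_def inv(1) by (auto simp: f_def)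
  moreover have "connected_labeling H f"
    unfolding connected_labeling_def
  proof (intro ballI impI)
    fix w assume "w \<in> verts H" "f w \<noteq> 1"
    then obtain x j where "l x = Some j" "x \<rightarrow>\<^bsub>H\<^esub> w" "j < f w" using inv(4)[OF lf] by blast
    then show "\<exists>x\<in>verts H. x \<rightarrow>\<^bsub>H\<^esub> w \<and> f x < f w" using lf wf by (metis option.inject)
  qed
  moreover have "l = ?g f"
    using lf dom by (intro ext) (auto simp: domIff)
  ultimately show "l \<in> ?g ` ?F" by blast
next
  fix l assume "l \<in> ?g ` ?F"
  then obtain f where f: "f \<in> bijective_labelings (verts H)" "connected_labeling H f" and l: "l = ?g f"
    by blast
  have "card (verts H) \<ge> 1" using fin ne by (simp add: Suc_leI card_gt_0_iff)
  then obtain v where "rw_state H v (card (verts H))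
      (\<lambda>x. if x \<in> verts H \<and> f x \<le> card (verts H) then Some (f x) else None)"
    using rw_state_complete[OF f fin sym] by blast
  \<comment> \<open>All labels are at most \<open>card (verts H)\<close>, so truncation at this
    bound changes nothing.\<close>
  moreover have "(\<lambda>x. if x \<in> verts H \<and> f x \<le> card (verts H) then Some (f x) else None) = l"
    using f(1) unfolding l bijective_labelings_def by (intro ext) (auto simp: PiE_iff)
  ultimately show "l \<in> ?L"
    unfolding random_walk_labeling_def by (auto simp: l split: if_splits)
qed

lemma num_random_walk_labelings_eq:
  assumes fin: "finite (verts H)" and sym: "\<And>x y. x \<rightarrow>\<^bsub>H\<^esub> y \<Longrightarrow> y \<rightarrow>\<^bsub>H\<^esub> x"
    and wf: "\<And>x y. x \<rightarrow>\<^bsub>H\<^esub> y \<Longrightarrow> x \<in> verts H \<and> y \<in> verts H" and ne: "verts H \<noteq> {}"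
  shows "num_random_walk_labelings H =
    card {f \<in> bijective_labelings (verts H). connected_labeling H f}"
proof -
  let ?F = "{f \<in> bijective_labelings (verts H). connected_labeling H f}"
  let ?g = "\<lambda>f x. if x \<in> verts H then Some (f x) else None"
  have "{l. random_walk_labeling H l} = ?g ` ?F"
    using assms by (rule random_walk_labelings_eq)
  \<comment> \<open>Extensional functions that agree on \<open>verts H\<close> are equal, so
    wrapping loses nothing.\<close>
  moreover have "inj_on ?g ?F"
  proof (rule inj_onI)
    fix f g assume fg: "f \<in> ?F" "g \<in> ?F" "?g f = ?g g"
    have "f x = g x" if "x \<in> verts H" for x
      using fun_cong[OF fg(3), of x] that by simp
    then show "f = g" using fg(1,2) unfolding bijective_labelings_def by (auto intro: PiE_ext)
  qed
  ultimately show ?thesis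
    unfolding num_random_walk_labelings_def by (simp add: card_image)
qed

section \<open>Barbell graphs\<close>

text \<open>The first labeled vertex of \<open>C\<close> does not carry label 1, so it has an
  earlier neighbour. That neighbour lies outside \<open>C\<close>, hence the arc is the bridge from
  \<open>u\<close> to \<open>v\<close>. Abstract \<open>A\<close>, \<open>C\<close> and
  \<open>E\<close> allow the two sides to be exchanged.\<close>

lemma two_least_bridge_if_connected:
  assumes f: "f \<in> bijective_labelings V" and V: "V = A \<union> C" "finite V" "A \<inter> C = {}"
    and uv: "u \<in> A" "v \<in> C"
    and con: "\<And>w. w \<in> V \<Longrightarrow> f w \<noteq> 1 \<Longrightarrow> \<exists>x. (x, w) \<in> E \<and> f x < f w"
    and E: "\<And>x w. (x, w) \<in> E \<Longrightarrow> w \<in> C \<Longrightarrow> x \<in> C \<or> x = u \<and> w = v"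
    and r: "r \<in> A" "f r = 1"
  shows "two_least f (insert u C) u v"
proof -
  define m where "m = arg_min_on f C"
  have m: "m \<in> C" "\<And>w. w \<in> C \<Longrightarrow> f m \<le> f w"
    using uv V arg_min_if_finite(1)[of C f] arg_min_least[of C _ f] unfolding m_def by auto
  have inj: "inj_on f V" using f unfolding bijective_labelings_def by blast
  have "f m \<noteq> 1" using inj m r V by (metis IntI UnI1 UnI2 empty_iff inj_onD)
  then obtain x where x: "(x, m) \<in> E" "f x < f m" using con m V by blast
  then have "x = u" "m = v" using E[OF x(1) m(1)] m(2)[of x] by auto
  moreover have "f m < f w" if "w \<in> C" "w \<noteq> m" for w
    using m that inj V by (metis UnI2 inj_onD le_neq_implies_less)
  ultimately show ?thesis using x by (auto simp: two_least_def)
qed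

text \<open>Label 1 lies at some \<open>r\<close> in \<open>A\<close>. The smaller neighbour is
  \<open>r\<close> for the other vertices of \<open>A\<close>, \<open>u\<close> for
  \<open>v\<close>, and \<open>v\<close> for the rest of \<open>C\<close>.\<close>

lemma connected_if_two_least_bridge:
  assumes f: "f \<in> bijective_labelings V" and V: "V = A \<union> C" "finite V"
    and uv: "u \<in> A" "v \<in> C"
    and E: "\<And>x w. x \<in> A \<Longrightarrow> w \<in> A \<Longrightarrow> x \<noteq> w \<Longrightarrow> (x, w) \<in> E"
      "\<And>x w. x \<in> C \<Longrightarrow> w \<in> C \<Longrightarrow> x \<noteq> w \<Longrightarrow> (x, w) \<in> E" "(u, v) \<in> E"
    and least: "two_least f (insert u C) u v" and w: "w \<in> V" "f w \<noteq> 1"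
  shows "\<exists>x\<in>V. (x, w) \<in> E \<and> f x < f w"
proof -
  have ge: "1 \<le> f x" if "x \<in> V" for x
    using f that by (auto simp: bijective_labelings_def PiE_iff)
  have "1 \<in> f ` V"
    using bijective_labelings_image[OF V(2) f] V w by (auto simp: Suc_le_eq card_gt_0_iff)
  then obtain r where r: "r \<in> V" "f r = 1" by auto
  \<comment> \<open>Every label on \<open>C - {u}\<close> is at least \<open>f v\<close>, which
    exceeds \<open>f u\<close> and hence 1.\<close>
  have "r \<notin> C - {u}"
  proof
    assume "r \<in> C - {u}"
    then have "f v \<le> f r" using least by (cases "r = v") (auto simp: two_least_def less_imp_le)
    moreover have "f u < f v" using least by (simp add: two_least_def)
    moreover have "1 \<le> f u" using ge uv(1) V(1) by blast
    ultimately show False using r(2) by linarith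
  qed
  then have "r \<in> A" using r V uv by blast
  consider "w \<in> A" | "w = v" | "w \<in> C - {u, v}" using w V uv by blast
  then show ?thesis
  proof cases
    case 1
    then show ?thesis using r w ge[OF w(1)] E(1)[OF \<open>r \<in> A\<close>, of w] by (metis le_neq_implies_less)
  next
    case 2
    then show ?thesis using E(3) least uv V by (auto simp: two_least_def)
  next
    case 3
    then show ?thesis using E(2)[OF uv(2), of w] least uv V by (auto simp: two_least_def)
  qed
qed

theorem corollary4:
  fixes n :: nat and B :: "'a pair_pre_digraph"
  assumes "n \<ge> 1" and "barbell_graph n B"
  shows "real (num_random_walk_labelings (with_proj B)) = 2 * fact (n - 1) * fact n * catalan n"
proof -
  obtain K1 K2 :: "'a pair_pre_digraph" and u v where K:
    "complete_digraph n (with_proj K1)" "complete_digraph n (with_proj K2)"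
    and disj: "pverts K1 \<inter> pverts K2 = {}" and uv: "u \<in> pverts K1" "v \<in> pverts K2"
    and B: "B = \<lparr> pverts = pverts K1 \<union> pverts K2,
      parcs = parcs K1 \<union> parcs K2 \<union> {(u, v), (v, u)} \<rparr>"
    using assms(2) unfolding barbell_graph_def by blast
  interpret pair_graph B using assms(2) by (rule barbell_graph_pair_graph)
  define A C V where "A = pverts K1" and "C = pverts K2" and "V = pverts B"
  have V: "V = A \<union> C" "finite V" using finite_verts by (simp_all add: A_def C_def V_def B)
  have disj: "A \<inter> C = {}" and uv: "u \<in> A" "v \<in> C" using disj uv by (simp_all add: A_def C_def)
  have card: "finite A" "finite C" "card A = n" "card C = n"
    using K V unfolding A_def C_def complete_digraph_pair_def by auto
  have arcs: "parcs B = {(x, w). x \<in> A \<and> w \<in> A \<and> x \<noteq> w} \<union> {(x, w). x \<in> C \<and> w \<in> C \<and> x \<noteq> w} \<union>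
      {(u, v), (v, u)}"
    using K unfolding A_def C_def complete_digraph_pair_def B by auto
  have cardV: "card V = 2 * n" using V disj card by (simp add: card_Un_disjoint)
  define F where "F a b S = {f \<in> bijective_labelings V. two_least f (insert a S) a b}" for a b S
  have con: "connected_labeling (with_proj B) f \<longleftrightarrow>
      (\<forall>w\<in>V. f w \<noteq> 1 \<longrightarrow> (\<exists>x\<in>V. (x, w) \<in> parcs B \<and> f x < f w))" for f
    by (simp add: connected_labeling_def V_def)
  have iff: "connected_labeling (with_proj B) f \<longleftrightarrow>
      two_least f (insert u C) u v \<or> two_least f (insert v A) v u"
    if f: "f \<in> bijective_labelings V" for f
  proof
    assume c: "connected_labeling (with_proj B) f"
    have "1 \<in> f ` V"
      using bijective_labelings_image[OF V(2) f] V uv by (auto simp: Suc_le_eq card_gt_0_iff)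
    then obtain r where r: "r \<in> V" "f r = 1" by auto
    \<comment> \<open>The side that holds label 1 decides which disjunct is true; the second case is
      the first with the sides exchanged.\<close>
    then consider "r \<in> A" | "r \<in> C" using V by blast
    then show "two_least f (insert u C) u v \<or> two_least f (insert v A) v u"
    proof cases
      case 1
      have "two_least f (insert u C) u v"
        by (rule two_least_bridge_if_connected[OF f V disj uv, of "parcs B" r])
          (use c 1 r disj uv in \<open>auto simp: con arcs\<close>)
      then show ?thesis ..
    next
      case 2
      have "two_least f (insert v A) v u"
        by (rule two_least_bridge_if_connected[OF f _ V(2) _ uv(2,1), of "parcs B" r])
          (use c 2 r disj uv V in \<open>auto simp: con arcs\<close>)
      then show ?thesis ..
    qed
  next
    assume "two_least f (insert u C) u v \<or> two_least f (insert v A) v u"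
    then show "connected_labeling (with_proj B) f"
    proof
      assume l: "two_least f (insert u C) u v"
      show ?thesis unfolding con
        by (intro ballI impI connected_if_two_least_bridge[OF f V uv _ _ _ l]) (auto simp: arcs)
    next
      assume l: "two_least f (insert v A) v u"
      show ?thesis unfolding con
        by (intro ballI impI connected_if_two_least_bridge[OF f _ V(2) uv(2,1) _ _ _ l])
          (auto simp: arcs V)
    qed
  qed
  \<comment> \<open>Each bridge end lies outside the opposite side, so the sets of competing
    vertices have size \<open>n + 1\<close>, which gives the factor \<open>(n + 1) * n\<close>
    below.\<close>
  have ne: "u \<notin> C" "v \<notin> A" "u \<noteq> v" using uv disj by auto
  then have "card (insert u C) = n + 1" "card (insert v A) = n + 1" using card by simp_all
  then have F: "(n + 1) * n * card (F u v C) = fact (2 * n)" "(n + 1) * n * card (F v u A) = fact (2 * n)"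
    using card_two_least[of V "insert u C" u v] card_two_least[of V "insert v A" v u] V uv ne cardV
    by (simp_all add: F_def)
  have "num_random_walk_labelings (with_proj B) =
      card {f \<in> bijective_labelings V. connected_labeling (with_proj B) f}"
    unfolding V_def
    using num_random_walk_labelings_eq[of "with_proj B"] uv V arcs_symmetric in_arcsD1 in_arcsD2
    by (simp add: V_def) blast
  also have "{f \<in> bijective_labelings V. connected_labeling (with_proj B) f} = F u v C \<union> F v u A"
    using iff unfolding F_def by blast
  \<comment> \<open>The two sets are disjoint: one requires \<open>f u < f v\<close>, the other the
    reverse.\<close>
  also have "card \<dots> = card (F u v C) + card (F v u A)"
    using finite_bijective_labelings[OF V(2)]
    by (intro card_Un_disjoint) (auto simp: F_def two_least_def)
  finally have "(n + 1) * n * num_random_walk_labelings (with_proj B) = 2 * fact (2 * n)"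
    using F by (simp add: distrib_left)
  then have "real ((n + 1) * n * num_random_walk_labelings (with_proj B)) = real (2 * fact (2 * n))"
    by presburger
  then have "(real n + 1) * real n * real (num_random_walk_labelings (with_proj B)) = 2 * fact (2 * n)"
    by (simp add: algebra_simps)
  \<comment> \<open>The factor \<open>n\<close> turns \<open>fact (n - 1)\<close> into
    \<open>fact n\<close>, and \<open>n + 1\<close> cancels the denominator of the Catalan number;
    the two copies of \<open>fact n\<close> times the central binomial coefficient give
    \<open>fact (2 * n)\<close>.\<close>
  moreover have "(real n + 1) * real n * (2 * fact (n - 1) * fact n * catalan n) = 2 * fact (2 * n)"
  proof -
    have "(real n + 1) * real n * (2 * fact (n - 1) * fact n * catalan n) =
        2 * ((real n * fact (n - 1)) * fact n * ((real n + 1) * catalan n))"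
      by (simp only: ac_simps)
    moreover have "(real n + 1) * catalan n = real ((2 * n) choose n)"
      by (simp add: catalan_def add_nonneg_eq_0_iff)
    moreover have "real n * fact (n - 1) = fact n" using assms(1) by (simp add: fact_reduce)
    moreover have "fact n * fact n * real ((2 * n) choose n) = fact (2 * n)"
      using binomial_fact_lemma[of n "2 * n"]
      by (metis add_diff_cancel_right' le_add2 mult_2 of_nat_fact of_nat_mult)
    ultimately show ?thesis by (simp only:)
  qed
  moreover have "(real n + 1) * real n \<noteq> 0"
    using assms(1) by (simp add: add_nonneg_eq_0_iff)
  ultimately show ?thesis
    by (metis mult_left_cancel)
qed

end
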